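(* (Family $(1/2,-,1/2)$, Painlevé III($\tilde D_8$).) Let $p,q$ be holomorphic functions of $t$ on a connected open set $U\subset\mathbb{C}^*$ with $q$ avoiding $0$. Put $$A_0=\begin{pmatrix}0&0\\-q&0\end{pmatrix},\quad A_1=\begin{pmatrix}\frac pq&-\frac tq\\1&-\frac pq\end{pmatrix},\quad A_2=\begin{pmatrix}0&1\\0&0\end{pmatrix},\quad B=\begin{pmatrix}0&\frac1q\\0&0\end{pmatrix}+\frac1z\begin{pmatrix}0&0\\\frac qt&0\end{pmatrix}.$$ Then the operators $\frac{d}{dz}+\frac1{z^2}A_0+\frac1zA_1+A_2$ and $\frac{d}{dt}+B$ commute if and only if $$\frac{dq}{dt}=\frac{2p+q}t,\qquad\frac{dp}{dt}=\frac{2p^2}{qt}+\frac pt+\frac{q^2}t-1 .$$ This system is the Hamiltonian system $\frac{dq}{dt}=-q^2\frac{\partial H}{\partial p}$, $\frac{dp}{dt}=q^2\frac{\partial H}{\partial q}$ with $$H=-\frac{p^2}{q^2t}-\frac p{qt}+\frac1q+\frac qt,$$ and, with $p=\frac12(tq'-q)$, it is equivalent to $$q''=\frac{(q')^2}q-\frac{q'}t+\frac{2q^2}{t^2}-\frac2t .$$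
   Context: Operators act on vector-valued functions of $(z,t)$; $\frac{d}{dz},\frac{d}{dt}$ are the partial derivatives. Two operators $\frac{d}{dz}+A$ and $\frac{d}{dt}+B$ with matrix functions $A(z,t),B(z,t)$ commute iff $\frac{\partial A}{\partial t}=\frac{\partial B}{\partial z}+AB-BA$ identically in $z,t$. In the Hamiltonian equations $H=H(p,q,t)$ with partial derivatives in the independent variables $p,q,t$; $'$ denotes $\frac{d}{dt}$. (This commutation is the isomonodromy condition for the family of connections.) *)

theory Defs
  imports "HOL-Complex_Analysis.Complex_Analysis"
begin

text \<open>Joint holomorphy: complex Frechet differentiability on a set \<open>D\<close> of pairs
  \<open>(z, t)\<close>; the derivative is the complex-linear map \<open>(h, k) \<mapsto> h a + k b\<close>.\<close>

definition holomorphic2_on ::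
  "(complex \<Rightarrow> complex \<Rightarrow> complex ^ 'n) \<Rightarrow> (complex \<times> complex) set \<Rightarrow> bool"  (infix \<open>holomorphic2'_on\<close> 50)
  where "Y holomorphic2_on D \<longleftrightarrow>
    (\<forall>x\<in>D. \<exists>a b. ((\<lambda>(z, t). Y z t) has_derivative (\<lambda>(h, k). h *s a + k *s b)) (at x))"

definition conn_z ::
  "(complex \<Rightarrow> complex \<Rightarrow> complex ^ 'n ^ 'n) \<Rightarrow>
   (complex \<Rightarrow> complex \<Rightarrow> complex ^ 'n) \<Rightarrow> complex \<Rightarrow> complex \<Rightarrow> complex ^ 'n"
  where "conn_z A Y z t = (\<chi> i. deriv (\<lambda>\<zeta>. Y \<zeta> t $ i) z) + A z t *v Y z t"

definition conn_t ::
  "(complex \<Rightarrow> complex \<Rightarrow> complex ^ 'n ^ 'n) \<Rightarrow>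
   (complex \<Rightarrow> complex \<Rightarrow> complex ^ 'n) \<Rightarrow> complex \<Rightarrow> complex \<Rightarrow> complex ^ 'n"
  where "conn_t B Y z t = (\<chi> i. deriv (\<lambda>\<tau>. Y z \<tau> $ i) t) + B z t *v Y z t"

definition commute_on ::
  "(complex \<times> complex) set \<Rightarrow>
   ((complex \<Rightarrow> complex \<Rightarrow> complex ^ 'n) \<Rightarrow> complex \<Rightarrow> complex \<Rightarrow> complex ^ 'n) \<Rightarrow>
   ((complex \<Rightarrow> complex \<Rightarrow> complex ^ 'n) \<Rightarrow> complex \<Rightarrow> complex \<Rightarrow> complex ^ 'n) \<Rightarrow> bool"
  where "commute_on D L M \<longleftrightarrow>
    (\<forall>Y. Y holomorphic2_on D \<longrightarrow> (\<forall>(z, t)\<in>D. L (M Y) z t = M (L Y) z t))"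

definition A0 :: "complex \<Rightarrow> complex ^ 2 ^ 2"
  where "A0 q = vector [vector [0, 0], vector [- q, 0]]"

definition A1 :: "complex \<Rightarrow> complex \<Rightarrow> complex \<Rightarrow> complex ^ 2 ^ 2"
  where "A1 p q t = vector [vector [p / q, - (t / q)], vector [1, - (p / q)]]"

definition A2 :: "complex ^ 2 ^ 2"
  where "A2 = vector [vector [0, 1], vector [0, 0]]"

definition A_mat ::
  "(complex \<Rightarrow> complex) \<Rightarrow> (complex \<Rightarrow> complex) \<Rightarrow> complex \<Rightarrow> complex \<Rightarrow> complex ^ 2 ^ 2"
  where "A_mat p q z t =
    mat (1 / z\<^sup>2) ** A0 (q t) + mat (1 / z) ** A1 (p t) (q t) t + A2"

definition B_mat :: "(complex \<Rightarrow> complex) \<Rightarrow> complex \<Rightarrow> complex \<Rightarrow> complex ^ 2 ^ 2"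
  where "B_mat q z t =
    vector [vector [0, 1 / q t], vector [0, 0]]
    + mat (1 / z) ** vector [vector [0, 0], vector [q t / t, 0]]"

definition q_rhs :: "complex \<Rightarrow> complex \<Rightarrow> complex \<Rightarrow> complex"
  where "q_rhs p q t = (2 * p + q) / t"

definition p_rhs :: "complex \<Rightarrow> complex \<Rightarrow> complex \<Rightarrow> complex"
  where "p_rhs p q t = 2 * p\<^sup>2 / (q * t) + p / t + q\<^sup>2 / t - 1"

definition PIII_system ::
  "(complex \<Rightarrow> complex) \<Rightarrow> (complex \<Rightarrow> complex) \<Rightarrow> complex set \<Rightarrow> bool"
  where "PIII_system p q U \<longleftrightarrow>
    (\<forall>t\<in>U. deriv q t = q_rhs (p t) (q t) t \<and> deriv p t = p_rhs (p t) (q t) t)"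

definition H_PIII :: "complex \<Rightarrow> complex \<Rightarrow> complex \<Rightarrow> complex"
  where "H_PIII p q t = - (p\<^sup>2 / (q\<^sup>2 * t)) - p / (q * t) + 1 / q + q / t"

definition ham_q_rhs ::
  "(complex \<Rightarrow> complex \<Rightarrow> complex \<Rightarrow> complex) \<Rightarrow> complex \<Rightarrow> complex \<Rightarrow> complex \<Rightarrow> complex"
  where "ham_q_rhs H p q t = - (q\<^sup>2) * deriv (\<lambda>x. H x q t) p"

definition ham_p_rhs ::
  "(complex \<Rightarrow> complex \<Rightarrow> complex \<Rightarrow> complex) \<Rightarrow> complex \<Rightarrow> complex \<Rightarrow> complex \<Rightarrow> complex"
  where "ham_p_rhs H p q t = q\<^sup>2 * deriv (\<lambda>y. H p y t) q"

definition hamiltonian_system ::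
  "(complex \<Rightarrow> complex \<Rightarrow> complex \<Rightarrow> complex) \<Rightarrow>
   (complex \<Rightarrow> complex) \<Rightarrow> (complex \<Rightarrow> complex) \<Rightarrow> complex set \<Rightarrow> bool"
  where "hamiltonian_system H p q U \<longleftrightarrow>
    (\<forall>t\<in>U. deriv q t = ham_q_rhs H (p t) (q t) t \<and> deriv p t = ham_p_rhs H (p t) (q t) t)"

definition PIII_equation :: "(complex \<Rightarrow> complex) \<Rightarrow> complex set \<Rightarrow> bool"
  where "PIII_equation q U \<longleftrightarrow>
    (\<forall>t\<in>U. deriv (deriv q) t =
       (deriv q t)\<^sup>2 / q t - deriv q t / t + 2 * (q t)\<^sup>2 / t\<^sup>2 - 2 / t)"

end

theory Submission
  imports Defs
begin

text \<open>Subtracting the two compositions leaves multiplication by the zero-curvature matrix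
  \<open>B\<^sub>z - A\<^sub>t + [A, B]\<close>, provided that the mixed partial derivatives of a jointly holomorphic
  function agree.  This matrix has only two independent entries: one vanishes iff
  \<open>t q' = 2 p + q\<close>, the other iff \<open>(p / q)' = q / t - 1 / q\<close>, and together these are the system.
  Conversely, the constant function \<open>(1, 0)\<close> already detects both entries.

  The mixed partials are handled by noting that the difference quotients of \<open>f\<close> in \<open>t\<close> converge
  locally uniformly in \<open>z\<close> (by a Cauchy estimate for the second \<open>t\<close>-derivative), so that the limit
  may be differentiated in \<open>z\<close> termwise.\<close>

no_notation fps_nth (infixl \<open>$\<close> 75)

section \<open>Equality of the mixed partial derivatives\<close>

text \<open>Every \<open>x\<close> in \<open>ball w r\<close> is the centre of a disc of radius
  \<open>r\<close> inside the doubled ball, so Cauchy's inequality bounds the second derivative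
  there by \<open>2 * M / r\<^sup>2\<close>; Taylor's formula does the rest. The form of the
  remainder used divides by \<open>fact 1\<close>, whence no factor 1/2. The constant involves only
  \<open>M\<close> and \<open>r\<close>, which later gives uniformity in the other variable.\<close>

lemma holomorphic_Taylor_linear_remainder:
  assumes hol: "f holomorphic_on ball w (2 * r)" and r: "0 < r"
    and M: "\<And>x. x \<in> ball w (2 * r) \<Longrightarrow> cmod (f x) \<le> M"
    and z: "z \<in> ball w r"
  shows "cmod (f z - f w - deriv f w * (z - w)) \<le> 2 * M / r\<^sup>2 * (cmod (z - w))\<^sup>2"
proof -
  have "cmod ((deriv ^^ 0) f z - (\<Sum>i\<le>1. (deriv ^^ i) f w * (z - w) ^ i / fact i))
      \<le> (2 * M / r\<^sup>2) * cmod (z - w) ^ Suc 1 / fact 1"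
  proof (rule complex_Taylor[where S = "ball w r"])
    fix i x assume x: "x \<in> ball w r"
    then have "x \<in> ball w (2 * r)" using r by auto
    then show "((deriv ^^ i) f has_field_derivative (deriv ^^ Suc i) f x) (at x within ball w r)"
      using holomorphic_derivI[OF holomorphic_higher_deriv[OF hol open_ball] open_ball] by simp
  next
    fix x assume x: "x \<in> ball w r"
    have sub: "cball x r \<subseteq> ball w (2 * r)"
      using x r by (simp add: cball_subset_ball_iff dist_commute)
    have "cmod ((deriv ^^ 2) f x) \<le> fact 2 * M / r ^ 2"
    proof (rule Cauchy_inequality)
      show "f holomorphic_on ball x r"
        using hol sub by (meson ball_subset_cball holomorphic_on_subset subset_trans)
      show "continuous_on (cball x r) f"
        using hol sub by (meson holomorphic_on_imp_continuous_on holomorphic_on_subset)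
      show "cmod (f y) \<le> M" if "cmod (x - y) = r" for y
        using that sub by (intro M) (auto simp: dist_norm subset_iff)
    qed fact
    then show "cmod ((deriv ^^ Suc 1) f x) \<le> 2 * M / r\<^sup>2"
      by (simp add: numeral_2_eq_2)
  qed (use z r in auto)
  then show ?thesis
    by (simp add: power2_eq_square algebra_simps)
qed

text \<open>The second conjunct identifies \<open>g'\<close> with the other mixed partial derivative as soon as the
  latter is known to exist, which follows by exchanging the roles of the variables.\<close>

lemma deriv_partial_has_field_derivative:
  fixes f :: "complex \<Rightarrow> complex \<Rightarrow> complex"
  assumes "open D" and cont: "continuous_on D (\<lambda>(z, t). f z t)"
    and dz: "\<And>z t. (z, t) \<in> D \<Longrightarrow> (\<lambda>\<zeta>. f \<zeta> t) field_differentiable at z"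
    and dt: "\<And>z t. (z, t) \<in> D \<Longrightarrow> f z field_differentiable at t"
    and D: "(z0, t0) \<in> D"
  shows "\<exists>g'. ((\<lambda>z. deriv (f z) t0) has_field_derivative g') (at z0) \<and>
     (\<exists>h. (\<forall>n. h n \<noteq> 0) \<and> h \<longlonglongrightarrow> 0 \<and>
       (\<lambda>n. (deriv (\<lambda>\<zeta>. f \<zeta> (t0 + h n)) z0 - deriv (\<lambda>\<zeta>. f \<zeta> t0) z0) / h n) \<longlonglongrightarrow> g')"
proof -
  obtain A B where "open A" "open B" "(z0, t0) \<in> A \<times> B" "A \<times> B \<subseteq> D"
    using open_prod_elim[OF \<open>open D\<close> D] .
  then have AB: "open A" "open B" "z0 \<in> A" "t0 \<in> B" "A \<times> B \<subseteq> D" by auto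
  obtain ra where ra: "ra > 0" "cball z0 ra \<subseteq> A" using AB open_contains_cball by blast
  obtain rb where rb: "rb > 0" "cball t0 rb \<subseteq> B" using AB open_contains_cball by blast
  \<comment> \<open>Halved so that the disc of radius \<open>2 * r\<close> about \<open>t0\<close>,
    demanded by the remainder estimate, stays in \<open>cball t0 rb\<close>.\<close>
  define r where "r = rb / 2"
  have r: "0 < r" using rb by (simp add: r_def)
  let ?K = "cball z0 ra \<times> cball t0 rb"
  have K: "?K \<subseteq> D" using ra rb AB by blast
  have "compact ((\<lambda>(z, t). f z t) ` ?K)"
    by (intro compact_continuous_image continuous_on_subset[OF cont K] compact_Times compact_cball)
  then obtain M where M0: "\<And>x. x \<in> (\<lambda>(z, t). f z t) ` ?K \<Longrightarrow> cmod x \<le> M"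
    using compact_imp_bounded bounded_iff by metis
  then have M: "cmod (f z t) \<le> M" if "z \<in> cball z0 ra" "t \<in> cball t0 rb" for z t
    using that by force
  \<comment> \<open>Nonzero steps tending to 0. The shift by 2 makes the norm strictly less than
    \<open>r\<close> already for \<open>n = 0\<close>, so that \<open>t0 + h n\<close> lies in the
    open ball of the estimate.\<close>
  define h where "h = (\<lambda>n. complex_of_real (r / real (n + 2)))"
  have h0: "h n \<noteq> 0" for n unfolding h_def of_real_eq_0_iff using r by simp
  have hr: "cmod (h n) < r" for n
  proof -
    have "cmod (h n) = r / real (n + 2)"
      unfolding h_def norm_of_real using r by simp
    also have "\<dots> < r / 1"
      by (rule divide_strict_left_mono) (use r in auto)
    finally show ?thesis by simp
  qed
  have h_lim: "h \<longlonglongrightarrow> 0"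
    unfolding h_def using tendsto_of_real[OF LIMSEQ_ignore_initial_segment[OF lim_const_over_n[of r], of 2]]
    by (simp only: of_real_0)
  have tb: "t0 + h n \<in> cball t0 rb" for n
    using hr[of n] r by (simp add: dist_norm r_def)
  define F where "F = (\<lambda>n z. (f z (t0 + h n) - f z t0) / h n)"
  define F' where "F' = (\<lambda>n z. (deriv (\<lambda>\<zeta>. f \<zeta> (t0 + h n)) z - deriv (\<lambda>\<zeta>. f \<zeta> t0) z) / h n)"
  \<comment> \<open>The quadratic remainder divided by \<open>h n\<close>. Since \<open>M\<close>
    bounds \<open>f\<close> on the whole compact bidisc, the right-hand side does not depend on
    \<open>z\<close>.\<close>
  have est: "cmod (F n z - deriv (f z) t0) \<le> 2 * M / r\<^sup>2 * cmod (h n)" if z: "z \<in> cball z0 ra" for n z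
  proof -
    have "cmod (f z (t0 + h n) - f z t0 - deriv (f z) t0 * (t0 + h n - t0))
        \<le> 2 * M / r\<^sup>2 * (cmod (t0 + h n - t0))\<^sup>2"
    proof (rule holomorphic_Taylor_linear_remainder)
      show "f z holomorphic_on ball t0 (2 * r)"
      proof (rule holomorphic_onI)
        fix x assume "x \<in> ball t0 (2 * r)"
        then have "(z, x) \<in> ?K" using z by (simp add: r_def)
        then have "(z, x) \<in> D" using K by blast
        then show "f z field_differentiable at x within ball t0 (2 * r)"
          by (rule field_differentiable_at_within[OF dt])
      qed
      show "cmod (f z x) \<le> M" if "x \<in> ball t0 (2 * r)" for x
        using that z by (intro M) (simp_all add: r_def)
    qed (use r hr[of n] in \<open>simp_all add: dist_norm\<close>)
    then have *: "cmod (f z (t0 + h n) - f z t0 - deriv (f z) t0 * h n) / cmod (h n)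
        \<le> 2 * M / r\<^sup>2 * cmod (h n)"
      using h0[of n] by (subst pos_divide_le_eq) (simp_all add: power2_eq_square mult_ac)
    have "F n z - deriv (f z) t0 = (f z (t0 + h n) - f z t0 - deriv (f z) t0 * h n) / h n"
      using h0[of n] by (simp add: F_def field_simps)
    with * show ?thesis by (simp add: norm_divide)
  qed
  have "(\<lambda>n. 2 * M / r\<^sup>2 * cmod (h n)) \<longlonglongrightarrow> 2 * M / r\<^sup>2 * cmod 0"
    by (intro tendsto_intros h_lim)
  then have bound_lim: "(\<lambda>n. 2 * M / r\<^sup>2 * cmod (h n)) \<longlonglongrightarrow> 0" by simp
  have ul: "uniform_limit (cball z0 ra) F (\<lambda>z. deriv (f z) t0) sequentially"
  proof (rule uniform_limitI)
    fix e :: real assume "e > 0"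
    with bound_lim have "\<forall>\<^sub>F n in sequentially. 2 * M / r\<^sup>2 * cmod (h n) < e"
      by (rule order_tendstoD)
    then show "\<forall>\<^sub>F n in sequentially. \<forall>z\<in>cball z0 ra. dist (F n z) (deriv (f z) t0) < e"
      by eventually_elim (simp add: dist_norm le_less_trans[OF est])
  qed
  have F_deriv: "(F n has_field_derivative F' n z) (at z)" if z: "z \<in> cball z0 ra" for n z
  proof -
    have "(z, t0 + h n) \<in> D" "(z, t0) \<in> D"
      using z tb[of n] K rb by auto
    then have "((\<lambda>\<zeta>. f \<zeta> (t0 + h n)) has_field_derivative deriv (\<lambda>\<zeta>. f \<zeta> (t0 + h n)) z) (at z)"
      "((\<lambda>\<zeta>. f \<zeta> t0) has_field_derivative deriv (\<lambda>\<zeta>. f \<zeta> t0) z) (at z)"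
      using dz DERIV_deriv_iff_field_differentiable by blast+
    then show ?thesis unfolding F_def F'_def
      by (intro DERIV_cdivide DERIV_diff)
  qed
  have F_cont: "continuous_on (cball z0 ra) (F n)" for n
    by (rule DERIV_continuous_on[OF has_field_derivative_at_within[OF F_deriv]])
  have "\<forall>\<^sub>F n in sequentially. continuous_on (cball z0 ra) (F n) \<and>
      (\<forall>w\<in>ball z0 ra. (F n has_field_derivative F' n w) (at w))"
    by (intro always_eventually allI conjI ballI F_cont F_deriv) auto
  \<comment> \<open>Weierstrass: the uniform limit is holomorphic and the derivatives
    \<open>F' n\<close> converge to its derivative. Both conjuncts of the claim come from this at
    the centre \<open>z0\<close>.\<close>
  from has_complex_derivative_uniform_limit[OF this ul sequentially_bot \<open>ra > 0\<close>]
  obtain g' where "\<And>w. w \<in> ball z0 ra \<Longrightarrow>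
      ((\<lambda>z. deriv (f z) t0) has_field_derivative g' w) (at w) \<and> (\<lambda>n. F' n w) \<longlonglongrightarrow> g' w"
    by blast
  then have "((\<lambda>z. deriv (f z) t0) has_field_derivative g' z0) (at z0) \<and> (\<lambda>n. F' n z0) \<longlonglongrightarrow> g' z0"
    using ra by simp
  then show ?thesis unfolding F'_def using h0 h_lim by blast
qed

text \<open>This is what makes the second-order terms cancel in the commutator. The hypotheses are
  symmetric in the two variables, so the preceding result applies to \<open>f\<close> and to its
  transpose.\<close>

lemma holomorphic_mixed_partials:
  fixes f :: "complex \<Rightarrow> complex \<Rightarrow> complex"
  assumes "open D" and cont: "continuous_on D (\<lambda>(z, t). f z t)"
    and dz: "\<And>z t. (z, t) \<in> D \<Longrightarrow> (\<lambda>\<zeta>. f \<zeta> t) field_differentiable at z"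
    and dt: "\<And>z t. (z, t) \<in> D \<Longrightarrow> f z field_differentiable at t"
    and D: "(z0, t0) \<in> D"
  obtains m where "((\<lambda>z. deriv (f z) t0) has_field_derivative m) (at z0)"
    and "((\<lambda>t. deriv (\<lambda>z. f z t) z0) has_field_derivative m) (at t0)"
proof -
  obtain m h where m: "((\<lambda>z. deriv (f z) t0) has_field_derivative m) (at z0)"
    and h: "\<And>n. h n \<noteq> 0" "h \<longlonglongrightarrow> 0"
      "(\<lambda>n. (deriv (\<lambda>\<zeta>. f \<zeta> (t0 + h n)) z0 - deriv (\<lambda>\<zeta>. f \<zeta> t0) z0) / h n) \<longlonglongrightarrow> m"
    using deriv_partial_has_field_derivative[OF assms] by blast
  let ?D = "prod.swap -` D"
  \<comment> \<open>The transposed function yields existence only; the value is compared with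
    \<open>m\<close> afterwards.\<close>
  have "\<exists>g'. ((\<lambda>t. deriv (\<lambda>z. f z t) z0) has_field_derivative g') (at t0)"
  proof -
    have 1: "open ?D"
      using \<open>open D\<close> continuous_on_swap by (metis open_vimage)
    have "continuous_on ?D ((\<lambda>(z, t). f z t) \<circ> prod.swap)"
      by (intro continuous_on_compose continuous_on_subset[OF cont])
        (auto intro: continuous_on_subset[OF continuous_on_swap])
    then have 2: "continuous_on ?D (\<lambda>(t, z). f z t)"
      by (simp add: comp_def case_prod_unfold)
    show ?thesis
      using deriv_partial_has_field_derivative[OF 1 2, of t0 z0] dz dt D by auto
  qed
  then obtain m' where m': "((\<lambda>t. deriv (\<lambda>z. f z t) z0) has_field_derivative m') (at t0)" ..
  then have "((\<lambda>k. (deriv (\<lambda>z. f z (t0 + k)) z0 - deriv (\<lambda>z. f z t0) z0) / k) \<longlongrightarrow> m') (at 0)"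
    by (simp add: DERIV_def)
  \<comment> \<open>As \<open>h\<close> tends to 0 without meeting it, the full limit
    \<open>m'\<close> may be sampled along \<open>h\<close>, where the quotients are already known
    to tend to \<open>m\<close>.\<close>
  moreover have "filterlim h (at 0) sequentially"
    using h by (simp add: filterlim_at)
  ultimately have "(\<lambda>n. (deriv (\<lambda>z. f z (t0 + h n)) z0 - deriv (\<lambda>z. f z t0) z0) / h n) \<longlonglongrightarrow> m'"
    by (rule filterlim_compose)
  with h(3) have "m = m'" using LIMSEQ_unique by blast
  with m m' that show thesis by blast
qed

section \<open>Components of jointly holomorphic functions\<close>

lemma holomorphic2_on_imp_continuous_on:
  fixes Y :: "complex \<Rightarrow> complex \<Rightarrow> complex ^ 'n"
  assumes "Y holomorphic2_on D"
  shows "continuous_on D (\<lambda>(z, t). Y z t $ i)"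
proof -
  have "continuous_on D (\<lambda>(z, t). Y z t)"
    using assms unfolding holomorphic2_on_def
    by (meson continuous_at_imp_continuous_on has_derivative_continuous)
  then have "continuous_on D (\<lambda>x. (case x of (z, t) \<Rightarrow> Y z t) $ i)"
    by (rule continuous_on_component)
  then show ?thesis by (simp add: case_prod_unfold)
qed

lemma holomorphic2_on_imp_field_differentiable:
  fixes Y :: "complex \<Rightarrow> complex \<Rightarrow> complex ^ 'n"
  assumes "Y holomorphic2_on D" "(z, t) \<in> D"
  shows "(\<lambda>\<zeta>. Y \<zeta> t $ i) field_differentiable at z" "(\<lambda>\<tau>. Y z \<tau> $ i) field_differentiable at t"
proof -
  obtain a b where ab:
    "((\<lambda>(z, t). Y z t) has_derivative (\<lambda>(h, k). h *s a + k *s b)) (at (z, t))"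
    using assms unfolding holomorphic2_on_def by blast
  \<comment> \<open>Composing with the two coordinate slices through \<open>(z, t)\<close> leaves
    only the \<open>a\<close> term, respectively only the \<open>b\<close> term, of the total
    derivative.\<close>
  have 1: "((\<lambda>\<zeta>. (\<zeta>, t)) has_derivative (\<lambda>h. (h, 0))) (at z)"
    and 2: "((\<lambda>\<tau>. (z, \<tau>)) has_derivative (\<lambda>k. (0, k))) (at t)"
    by (auto intro!: derivative_eq_intros)
  have "((\<lambda>\<zeta>. Y \<zeta> t) has_derivative (\<lambda>h. h *s a)) (at z)"
    using has_derivative_compose[OF 1 ab] by simp
  from bounded_linear.has_derivative[OF bounded_linear_vec_nth this, of i]
  show "(\<lambda>\<zeta>. Y \<zeta> t $ i) field_differentiable at z"
    unfolding field_differentiable_def has_field_derivative_def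
    by (intro exI[of _ "a $ i"]) (simp add: mult_commute_abs)
  have "((\<lambda>\<tau>. Y z \<tau>) has_derivative (\<lambda>k. k *s b)) (at t)"
    using has_derivative_compose[OF 2 ab] by simp
  from bounded_linear.has_derivative[OF bounded_linear_vec_nth this, of i]
  show "(\<lambda>\<tau>. Y z \<tau> $ i) field_differentiable at t"
    unfolding field_differentiable_def has_field_derivative_def
    by (intro exI[of _ "b $ i"]) (simp add: mult_commute_abs)
qed

section \<open>The commutator of the two connections\<close>

lemma conn_z_A_mat:
  fixes Y :: "complex \<Rightarrow> complex \<Rightarrow> complex ^ 2"
  shows
  "conn_z (A_mat p q) Y z t $ 1 =
     deriv (\<lambda>\<zeta>. Y \<zeta> t $ 1) z + p t / (q t * z) * Y z t $ 1 + (1 - t / (q t * z)) * Y z t $ 2"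
  "conn_z (A_mat p q) Y z t $ 2 =
     deriv (\<lambda>\<zeta>. Y \<zeta> t $ 2) z + (1 / z - q t / z\<^sup>2) * Y z t $ 1 - p t / (q t * z) * Y z t $ 2"
  by (simp_all add: conn_z_def A_mat_def A0_def A1_def A2_def matrix_vector_mult_def sum_2
      matrix_matrix_mult_def mat_def algebra_simps)

lemma conn_t_B_mat:
  fixes Y :: "complex \<Rightarrow> complex \<Rightarrow> complex ^ 2"
  shows
  "conn_t (B_mat q) Y z t $ 1 = deriv (\<lambda>\<tau>. Y z \<tau> $ 1) t + 1 / q t * Y z t $ 2"
  "conn_t (B_mat q) Y z t $ 2 = deriv (\<lambda>\<tau>. Y z \<tau> $ 2) t + q t / (t * z) * Y z t $ 1"
  by (simp_all add: conn_t_def B_mat_def matrix_vector_mult_def sum_2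
      matrix_matrix_mult_def mat_def algebra_simps)

text \<open>The mixed partials agree and the first-order terms occur identically in both
  compositions, so only multiplication by a matrix survives. It is traceless because A and B are,
  hence \<alpha> on the diagonal with opposite signs; both off-diagonal entries turn out to be
  multiples of \<beta>.\<close>

lemma conn_commutator:
  fixes Y :: "complex \<Rightarrow> complex \<Rightarrow> complex ^ 2"
  assumes D: "open D" "(z, t) \<in> D" and Y: "Y holomorphic2_on D"
    and p: "p field_differentiable at t" and q: "q field_differentiable at t"
    and nz: "z \<noteq> 0" "t \<noteq> 0" "q t \<noteq> 0"
  defines "L \<equiv> conn_z (A_mat p q)" and "M \<equiv> conn_t (B_mat q)"
    and "\<alpha> \<equiv> q t / t - 1 / q t - (deriv p t / q t - p t * deriv q t / (q t)\<^sup>2)"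
    and "\<beta> \<equiv> 2 * p t + q t - t * deriv q t"
  shows "L (M Y) z t $ 1 - M (L Y) z t $ 1 = \<alpha> / z * Y z t $ 1 + \<beta> / ((q t)\<^sup>2 * z) * Y z t $ 2"
    and "L (M Y) z t $ 2 - M (L Y) z t $ 2 = - \<beta> / (t * z\<^sup>2) * Y z t $ 1 - \<alpha> / z * Y z t $ 2"
proof -
  have ydz: "((\<lambda>\<zeta>. Y \<zeta> t $ i) has_field_derivative deriv (\<lambda>\<zeta>. Y \<zeta> t $ i) z) (at z)" for i
    using holomorphic2_on_imp_field_differentiable(1)[OF Y D(2)] DERIV_deriv_iff_field_differentiable
    by blast
  have ydt: "((\<lambda>\<tau>. Y z \<tau> $ i) has_field_derivative deriv (\<lambda>\<tau>. Y z \<tau> $ i) t) (at t)" for i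
    using holomorphic2_on_imp_field_differentiable(2)[OF Y D(2)] DERIV_deriv_iff_field_differentiable
    by blast
  have "\<exists>m. ((\<lambda>\<zeta>. deriv (\<lambda>\<tau>. Y \<zeta> \<tau> $ i) t) has_field_derivative m) (at z) \<and>
      ((\<lambda>\<tau>. deriv (\<lambda>\<zeta>. Y \<zeta> \<tau> $ i) z) has_field_derivative m) (at t)" for i
    using holomorphic_mixed_partials[OF D(1) holomorphic2_on_imp_continuous_on[OF Y]
        holomorphic2_on_imp_field_differentiable(1)[OF Y]
        holomorphic2_on_imp_field_differentiable(2)[OF Y] D(2)]
    by blast
  then obtain m where m: "\<And>i. ((\<lambda>\<zeta>. deriv (\<lambda>\<tau>. Y \<zeta> \<tau> $ i) t) has_field_derivative m i) (at z)"
      "\<And>i. ((\<lambda>\<tau>. deriv (\<lambda>\<zeta>. Y \<zeta> \<tau> $ i) z) has_field_derivative m i) (at t)"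
    by metis
  have p': "(p has_field_derivative deriv p t) (at t)" and q': "(q has_field_derivative deriv q t) (at t)"
    using p q DERIV_deriv_iff_field_differentiable by blast+
  \<comment> \<open>A has rows \<open>(a, b)\<close> and \<open>(c, - a)\<close>; B has off-diagonal
    entries \<open>1 / q t\<close> and \<open>d\<close>. Below, \<open>\<pi>\<close> is the
    derivative of p/q.\<close>
  define a b c d where "a = p t / (q t * z)" and "b = 1 - t / (q t * z)"
    and "c = 1 / z - q t / z\<^sup>2" and "d = q t / (t * z)"
  define \<pi> where "\<pi> = deriv p t / q t - p t * deriv q t / (q t)\<^sup>2"
  have nz': "q t * z \<noteq> 0" "t * z \<noteq> 0" "z\<^sup>2 \<noteq> 0" using nz by auto
  have da: "((\<lambda>\<tau>. p \<tau> / (q \<tau> * z)) has_field_derivative \<pi> / z) (at t)"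
    by (rule derivative_eq_intros p' q' refl nz')+
      (use nz in \<open>simp_all add: \<pi>_def field_simps power2_eq_square\<close>)
  have db: "((\<lambda>\<tau>. 1 - \<tau> / (q \<tau> * z)) has_field_derivative
      - ((1 / q t - t * deriv q t / (q t)\<^sup>2) / z)) (at t)"
    by (rule derivative_eq_intros q' refl nz')+
      (use nz in \<open>simp_all add: field_simps power2_eq_square\<close>)
  have dc: "((\<lambda>\<tau>. 1 / z - q \<tau> / z\<^sup>2) has_field_derivative - (deriv q t / z\<^sup>2)) (at t)"
    by (rule derivative_eq_intros q' refl nz')+ (use nz in \<open>simp_all add: field_simps power2_eq_square\<close>)
  have dd: "((\<lambda>\<zeta>. q t / (t * \<zeta>)) has_field_derivative - (q t / (t * z\<^sup>2))) (at z)"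
    by (rule derivative_eq_intros refl nz')+
      (use nz in \<open>simp_all add: field_simps power2_eq_square\<close>)
  \<comment> \<open>The entry \<open>1 / q t\<close> is constant in z while \<open>d\<close> is not,
    so B_z contributes to the second component only.\<close>
  have M1: "((\<lambda>\<zeta>. M Y \<zeta> t $ 1) has_field_derivative m 1 + 1 / q t * deriv (\<lambda>\<zeta>. Y \<zeta> t $ 2) z) (at z)"
    unfolding M_def conn_t_B_mat by (intro DERIV_add DERIV_cmult m ydz)
  have M2: "((\<lambda>\<zeta>. M Y \<zeta> t $ 2) has_field_derivative
      m 2 + (- (q t / (t * z\<^sup>2)) * Y z t $ 1 + deriv (\<lambda>\<zeta>. Y \<zeta> t $ 1) z * d)) (at z)"
    unfolding M_def conn_t_B_mat d_def by (intro DERIV_add DERIV_mult m ydz dd)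
  have L1: "((\<lambda>\<tau>. L Y z \<tau> $ 1) has_field_derivative
      m 1 + (\<pi> / z * Y z t $ 1 + deriv (\<lambda>\<tau>. Y z \<tau> $ 1) t * a)
      + (- ((1 / q t - t * deriv q t / (q t)\<^sup>2) / z) * Y z t $ 2
        + deriv (\<lambda>\<tau>. Y z \<tau> $ 2) t * b)) (at t)"
    unfolding L_def conn_z_A_mat a_def b_def by (intro DERIV_add DERIV_mult m ydt da db)
  have L2: "((\<lambda>\<tau>. L Y z \<tau> $ 2) has_field_derivative
      m 2 + (- (deriv q t / z\<^sup>2) * Y z t $ 1 + deriv (\<lambda>\<tau>. Y z \<tau> $ 1) t * c)
      - (\<pi> / z * Y z t $ 2 + deriv (\<lambda>\<tau>. Y z \<tau> $ 2) t * a)) (at t)"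
    unfolding L_def conn_z_A_mat a_def c_def by (intro DERIV_add DERIV_diff DERIV_mult m ydt da dc)
  note eqs = DERIV_imp_deriv[OF M1] DERIV_imp_deriv[OF M2] DERIV_imp_deriv[OF L1] DERIV_imp_deriv[OF L2]
  note LM = conn_z_A_mat[of p q "M Y", folded L_def] conn_t_B_mat[of q "L Y", folded M_def]
  have LY: "L Y z t $ 1 = deriv (\<lambda>\<zeta>. Y \<zeta> t $ 1) z + a * Y z t $ 1 + b * Y z t $ 2"
      "L Y z t $ 2 = deriv (\<lambda>\<zeta>. Y \<zeta> t $ 2) z + c * Y z t $ 1 - a * Y z t $ 2"
    by (simp_all add: L_def conn_z_A_mat a_def b_def c_def)
  have MY: "M Y z t $ 1 = deriv (\<lambda>\<tau>. Y z \<tau> $ 1) t + 1 / q t * Y z t $ 2"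
      "M Y z t $ 2 = deriv (\<lambda>\<tau>. Y z \<tau> $ 2) t + d * Y z t $ 1"
    by (simp_all add: M_def conn_t_B_mat d_def)
  \<comment> \<open>In this first row, \<open>b * d - 1 / q t * c\<close> and
    \<open>2 * a * (1 / q t)\<close> are the entries of [A, B]; the remaining terms come from
    -A_t.\<close>
  have "L (M Y) z t $ 1 - M (L Y) z t $ 1 =
      (b * d - 1 / q t * c - \<pi> / z) * Y z t $ 1
      + (2 * a * (1 / q t) + (1 / q t - t * deriv q t / (q t)\<^sup>2) / z) * Y z t $ 2"
    unfolding LM eqs LY MY a_def[symmetric] b_def[symmetric] \<pi>_def[symmetric]
    by (simp only: algebra_simps) (simp add: algebra_simps)
  \<comment> \<open>The 1/z^2 parts of \<open>b * d\<close> and \<open>1 / q t * c\<close> are equal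
    and cancel.\<close>
  also have "b * d - 1 / q t * c - \<pi> / z = \<alpha> / z"
    unfolding b_def c_def d_def \<alpha>_def \<pi>_def[symmetric]
    using nz by (simp add: field_simps power2_eq_square)
  also have "2 * a * (1 / q t) + (1 / q t - t * deriv q t / (q t)\<^sup>2) / z = \<beta> / ((q t)\<^sup>2 * z)"
    unfolding a_def \<beta>_def using nz by (simp add: field_simps power2_eq_square)
  finally show "L (M Y) z t $ 1 - M (L Y) z t $ 1 = \<alpha> / z * Y z t $ 1 + \<beta> / ((q t)\<^sup>2 * z) * Y z t $ 2" .
  have "L (M Y) z t $ 2 - M (L Y) z t $ 2 =
      (deriv q t / z\<^sup>2 - q t / (t * z\<^sup>2) - 2 * a * d) * Y z t $ 1
      - (b * d - 1 / q t * c - \<pi> / z) * Y z t $ 2"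
    unfolding LM eqs LY MY a_def[symmetric] c_def[symmetric] d_def[symmetric] \<pi>_def[symmetric]
    by (simp only: algebra_simps) (simp add: algebra_simps)
  also have "b * d - 1 / q t * c - \<pi> / z = \<alpha> / z" by fact
  also have "deriv q t / z\<^sup>2 - q t / (t * z\<^sup>2) - 2 * a * d = - \<beta> / (t * z\<^sup>2)"
    unfolding a_def d_def \<beta>_def using nz by (simp add: field_simps power2_eq_square)
  finally show "L (M Y) z t $ 2 - M (L Y) z t $ 2 = - \<beta> / (t * z\<^sup>2) * Y z t $ 1 - \<alpha> / z * Y z t $ 2" .
qed

section \<open>The Painleve system: commutation, Hamiltonian form and scalar equation\<close>

text \<open>Pointwise algebra, with \<open>x\<close>, \<open>y\<close>, \<open>x'\<close>,
  \<open>y'\<close> standing for p, q and their derivatives. The first conditions match after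
  clearing \<open>s\<close>. The derivative of p/q involves \<open>y'\<close> but
  \<open>p_rhs\<close> does not, so the second conditions are compared only after \<open>y'\<close>
  has been replaced by \<open>q_rhs\<close>.\<close>

lemma PIII_rhs_iff:
  fixes x y s x' y' :: complex
  assumes "y \<noteq> 0" "s \<noteq> 0"
  shows "y' = q_rhs x y s \<and> x' = p_rhs x y s \<longleftrightarrow>
    2 * x + y - s * y' = 0 \<and> y / s - 1 / y - (x' / y - x * y' / y\<^sup>2) = 0"
proof -
  have 1: "y' = q_rhs x y s \<longleftrightarrow> 2 * x + y - s * y' = 0"
    using assms by (auto simp: q_rhs_def field_simps)
  have 2: "y / s - 1 / y - (x' / y - x * y' / y\<^sup>2) = (p_rhs x y s - x') / y"
    if y': "y' = q_rhs x y s"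
    unfolding y' q_rhs_def p_rhs_def using assms by (simp add: field_simps power2_eq_square)
  show ?thesis
    using 1 2 assms by auto
qed

text \<open>The weight q^2 is that of the Poisson bracket {p, q} = q^2; it lowers the powers of
  \<open>y\<close> in the denominators of both partial derivatives of H.\<close>

lemma H_PIII_hamiltonian:
  assumes "y \<noteq> 0" "s \<noteq> 0"
  shows "ham_q_rhs H_PIII x y s = q_rhs x y s" and "ham_p_rhs H_PIII x y s = p_rhs x y s"
proof -
  have "((\<lambda>x. H_PIII x y s) has_field_derivative - (2 * x / (y\<^sup>2 * s)) - 1 / (y * s)) (at x)"
    unfolding H_PIII_def
    by (rule derivative_eq_intros refl assms | use assms in \<open>simp add: field_simps power2_eq_square\<close>)+
  note H' = DERIV_imp_deriv[OF this]
  show "ham_q_rhs H_PIII x y s = q_rhs x y s"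
    unfolding ham_q_rhs_def q_rhs_def H'
    using assms by (simp add: field_simps power2_eq_square)
  have "((\<lambda>y. H_PIII x y s) has_field_derivative
      2 * x\<^sup>2 / (y ^ 3 * s) + x / (y\<^sup>2 * s) - 1 / y\<^sup>2 + 1 / s) (at y)"
    unfolding H_PIII_def
    by (rule derivative_eq_intros refl assms
        | use assms in \<open>simp add: field_simps power2_eq_square power3_eq_cube\<close>)+
  note H' = DERIV_imp_deriv[OF this]
  show "ham_p_rhs H_PIII x y s = p_rhs x y s"
    unfolding ham_p_rhs_def p_rhs_def H'
    using assms by (simp add: field_simps power2_eq_square power3_eq_cube)
qed

lemma commute_on_iff_PIII_system:
  assumes "open U" "U \<subseteq> - {0}" "p holomorphic_on U" "q holomorphic_on U"
    and q0: "\<And>t. t \<in> U \<Longrightarrow> q t \<noteq> 0"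
  shows "commute_on ((- {0}) \<times> U) (conn_z (A_mat p q)) (conn_t (B_mat q)) \<longleftrightarrow> PIII_system p q U"
    (is "commute_on ?D ?L ?M \<longleftrightarrow> _")
proof -
  have D: "open ?D" using assms by (intro open_Times) auto
  define \<alpha> where "\<alpha> = (\<lambda>t. q t / t - 1 / q t - (deriv p t / q t - p t * deriv q t / (q t)\<^sup>2))"
  define \<beta> where "\<beta> = (\<lambda>t. 2 * p t + q t - t * deriv q t)"
  have t0: "t \<noteq> 0" if "t \<in> U" for t using assms that by auto
  have sys: "PIII_system p q U \<longleftrightarrow> (\<forall>t\<in>U. \<beta> t = 0 \<and> \<alpha> t = 0)"
    unfolding PIII_system_def \<alpha>_def \<beta>_def using PIII_rhs_iff[OF q0 t0] by blast
  have comm: "?L (?M Y) z t $ 1 - ?M (?L Y) z t $ 1 = \<alpha> t / z * Y z t $ 1 + \<beta> t / ((q t)\<^sup>2 * z) * Y z t $ 2"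
      "?L (?M Y) z t $ 2 - ?M (?L Y) z t $ 2 = - \<beta> t / (t * z\<^sup>2) * Y z t $ 1 - \<alpha> t / z * Y z t $ 2"
    if "(Y :: complex \<Rightarrow> complex \<Rightarrow> complex ^ 2) holomorphic2_on ?D" "z \<noteq> 0" "t \<in> U" for Y z t
  proof -
    have *: "(z, t) \<in> ?D" "p field_differentiable at t" "q field_differentiable at t"
      using that assms holomorphic_on_imp_differentiable_at by auto
    note conn_commutator[OF D *(1) that(1) *(2,3) that(2) t0[OF that(3)] q0[OF that(3)],
        folded \<alpha>_def \<beta>_def]
    then show "?L (?M Y) z t $ 1 - ?M (?L Y) z t $ 1
          = \<alpha> t / z * Y z t $ 1 + \<beta> t / ((q t)\<^sup>2 * z) * Y z t $ 2"
      "?L (?M Y) z t $ 2 - ?M (?L Y) z t $ 2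
          = - \<beta> t / (t * z\<^sup>2) * Y z t $ 1 - \<alpha> t / z * Y z t $ 2"
      by (simp_all only: \<alpha>_def \<beta>_def)
  qed
  show ?thesis unfolding sys
  proof
    assume C: "commute_on ?D ?L ?M"
    \<comment> \<open>This picks out the first column, whose entries are one multiple of \<alpha>
      and one of \<beta>. As z enters only through nonvanishing factors, evaluation at z = 1
      suffices.\<close>
    let ?Y = "\<lambda>_ _. vector [1, 0] :: complex ^ 2"
    have Y: "?Y holomorphic2_on ?D"
      unfolding holomorphic2_on_def by (auto intro!: exI[of _ 0] simp: case_prod_unfold)
    show "\<forall>t\<in>U. \<beta> t = 0 \<and> \<alpha> t = 0"
    proof
      fix t assume t: "t \<in> U"
      have "?L (?M ?Y) 1 t = ?M (?L ?Y) 1 t"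
        using C Y t unfolding commute_on_def by auto
      then show "\<beta> t = 0 \<and> \<alpha> t = 0"
        using comm[OF Y, of 1 t] t t0[OF t] by simp
    qed
  next
    assume "\<forall>t\<in>U. \<beta> t = 0 \<and> \<alpha> t = 0"
    then show "commute_on ?D ?L ?M"
      unfolding commute_on_def using comm by (auto simp: vec_eq_iff forall_2)
  qed
qed

text \<open>The first equation is linear in p and can be solved for it. With this p, the second
  equation becomes the scalar equation multiplied by t/2, which is nonzero on
  \<open>U\<close>.\<close>

lemma PIII_system_iff_PIII_equation:
  assumes U: "open U" "U \<subseteq> - {0}" and q: "q holomorphic_on U"
    and q0: "\<And>t. t \<in> U \<Longrightarrow> q t \<noteq> 0"
  shows "PIII_system p q U \<longleftrightarrow>
    (\<forall>t\<in>U. p t = (t * deriv q t - q t) / 2) \<and> PIII_equation q U"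
proof -
  have t0: "t \<noteq> 0" if "t \<in> U" for t using U that by auto
  have q_iff: "deriv q t = q_rhs (p t) (q t) t \<longleftrightarrow> p t = (t * deriv q t - q t) / 2"
    if "t \<in> U" for t
    using t0[OF that] by (auto simp: q_rhs_def field_simps)
  have p_iff: "deriv p t = p_rhs (p t) (q t) t \<longleftrightarrow>
      deriv (deriv q) t = (deriv q t)\<^sup>2 / q t - deriv q t / t + 2 * (q t)\<^sup>2 / t\<^sup>2 - 2 / t"
    if p: "\<forall>t\<in>U. p t = (t * deriv q t - q t) / 2" and t: "t \<in> U" for t
  proof -
    have q': "(q has_field_derivative deriv q t) (at t)"
      and q'': "(deriv q has_field_derivative deriv (deriv q) t) (at t)"
      using q U t by (auto intro: holomorphic_derivI holomorphic_deriv)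
    \<comment> \<open>The product rule gives q' + t q'' - q', so no first derivative
      remains.\<close>
    have "((\<lambda>t. (t * deriv q t - q t) / 2) has_field_derivative t * deriv (deriv q) t / 2) (at t)"
      by (rule derivative_eq_intros refl q' q'' | simp)+
    \<comment> \<open>The formula for p is differentiated, so it must hold on a neighbourhood of
      \<open>t\<close>; this is why it is assumed on all of the open set \<open>U\<close>.\<close>
    then have "(p has_field_derivative t * deriv (deriv q) t / 2) (at t)"
      by (rule has_field_derivative_transform_within_open[OF _ U(1) t]) (use p in auto)
    then have p': "deriv p t = t * deriv (deriv q) t / 2"
      by (rule DERIV_imp_deriv)
    have "p_rhs (p t) (q t) t =
        t / 2 * ((deriv q t)\<^sup>2 / q t - deriv q t / t + 2 * (q t)\<^sup>2 / t\<^sup>2 - 2 / t)"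
      unfolding p_rhs_def bspec[OF p t]
      using t0[OF t] q0[OF t] by (simp add: field_simps power2_eq_square)
    then show ?thesis
      unfolding p' using t0[OF t] by simp
  qed
  show ?thesis
    unfolding PIII_system_def PIII_equation_def using q_iff p_iff by blast
qed

theorem mainTheorem15:
  fixes p q :: "complex \<Rightarrow> complex" and U :: "complex set"
  assumes "open U" and "connected U" and "U \<subseteq> - {0}"
    and "p holomorphic_on U" and "q holomorphic_on U"
    and "\<And>t. t \<in> U \<Longrightarrow> q t \<noteq> 0"
  shows "(commute_on ((- {0}) \<times> U) (conn_z (A_mat p q)) (conn_t (B_mat q)) \<longleftrightarrow> PIII_system p q U)
    \<and> (\<forall>x y s. y \<noteq> 0 \<longrightarrow> s \<noteq> 0 \<longrightarrow>
           q_rhs x y s = ham_q_rhs H_PIII x y s \<and> p_rhs x y s = ham_p_rhs H_PIII x y s)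
    \<and> (PIII_system p q U \<longleftrightarrow> hamiltonian_system H_PIII p q U)
    \<and> (PIII_system p q U \<longleftrightarrow>
           (\<forall>t\<in>U. p t = (t * deriv q t - q t) / 2) \<and> PIII_equation q U)"
proof (intro conjI)
  have t0: "t \<noteq> 0" if "t \<in> U" for t using assms(3) that by auto
  show "commute_on ((- {0}) \<times> U) (conn_z (A_mat p q)) (conn_t (B_mat q)) \<longleftrightarrow> PIII_system p q U"
    using assms by (intro commute_on_iff_PIII_system) auto
  show "\<forall>x y s. y \<noteq> 0 \<longrightarrow> s \<noteq> 0 \<longrightarrow>
      q_rhs x y s = ham_q_rhs H_PIII x y s \<and> p_rhs x y s = ham_p_rhs H_PIII x y s"
    using H_PIII_hamiltonian by simp
  show "PIII_system p q U \<longleftrightarrow> hamiltonian_system H_PIII p q U"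
    unfolding PIII_system_def hamiltonian_system_def
    using H_PIII_hamiltonian assms(6) t0 by auto
  show "PIII_system p q U \<longleftrightarrow>
      (\<forall>t\<in>U. p t = (t * deriv q t - q t) / 2) \<and> PIII_equation q U"
    using assms by (intro PIII_system_iff_PIII_equation) auto
qed

end
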